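(* Let $m\ge1$ be an integer, $\tfrac12<p<1$ and $q=1-p$. Let $\mathcal{U}$ be the first hitting time of $0$ by the nearest-neighbour random walk on $\mathbb{N}$ started at $m$ that at each step moves by $-1$ with probability $p$ and by $+1$ with probability $q$, and for $\rho\in(0,1)$ let $\mathcal{T}=\mathcal{T}_\rho$ be the first passage time to $0$ of this walk under geometric restart with parameter $\rho$. Set $$m^*=\frac{8p(1-p)-1}{2p-1},\qquad p^*=\frac{4-m+\sqrt{m^2+8}}{8}.$$ Then: (i) $m<m^*$ if and only if $p<p^*$; (ii) if $m<m^*$, there exists $\rho^*\in(0,1)$ such that $\mathbb{E}[\mathcal{T}_\rho]<\mathbb{E}[\mathcal{U}]$ for all $\rho\in(0,\rho^* )$; (iii) if $m\ge m^*$, then $\mathbb{E}[\mathcal{T}_\rho]>\mathbb{E}[\mathcal{U}]$ for all $\rho\in(0,1)$. In particular, if $p\ge\tfrac34$, geometric restart is not beneficial for any $\rho\in(0,1)$.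
   Context: $\mathbb{N}=\{0,1,2,\ldots\}$. Geometric restart with parameter $\rho\in(0,1)$: the restart time $\mathcal{R}$ is independent of $\mathcal{U}$ with $\mathbb{P}(\mathcal{R}=n)=\rho(1-\rho)^{n-1}$ for $n=1,2,3,\ldots$. The first passage time under restart $\mathcal{T}$ is defined recursively by $\mathcal{T}=\mathcal{U}$ if $\mathcal{R}>\mathcal{U}$ and $\mathcal{T}=\mathcal{R}+\mathcal{T}^*$ if $\mathcal{R}\le\mathcal{U}$, where $\mathcal{T}^*$ is a copy of $\mathcal{T}$ with the same distribution, independent of $(\mathcal{U},\mathcal{R})$ (ties count as restarts). Explicitly: let $(\mathcal{U}_k,\mathcal{R}_k)_{k\ge1}$ be i.i.d. copies of $(\mathcal{U},\mathcal{R})$ and $\kappa=\inf\{k\ge1:\mathcal{R}_k>\mathcal{U}_k\}$ (almost surely finite here); then $\mathcal{T}=\sum_{j<\kappa}\mathcal{R}_j+\mathcal{U}_\kappa$. Restart is called beneficial if $\mathbb{E}[\mathcal{T}]<\mathbb{E}[\mathcal{U}]$. *)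

theory Defs
  imports "HOL-Probability.Probability"
begin

text \<open>
  The transition rule is imposed only from states \<open>x \<ge> 1\<close>. What the walk does after reaching \<open>0\<close>
  is left unconstrained, since it has no influence on the first hitting time of \<open>0\<close>.
\<close>

definition step_prob :: "real \<Rightarrow> nat \<Rightarrow> nat \<Rightarrow> real" where
  "step_prob p x y = (if y + 1 = x then p else if y = x + 1 then 1 - p else 0)"

definition nn_walk :: "'a measure \<Rightarrow> nat \<Rightarrow> real \<Rightarrow> (nat \<Rightarrow> 'a \<Rightarrow> nat) \<Rightarrow> bool" where
  "nn_walk M m p X \<longleftrightarrow>
     prob_space M \<and>
     (\<forall>n. X n \<in> measurable M (count_space UNIV)) \<and>
     (AE \<omega> in M. X 0 \<omega> = m) \<and>
     (\<forall>n (s :: nat \<Rightarrow> nat). s n \<ge> 1 \<longrightarrow>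
        measure M {\<omega> \<in> space M. \<forall>i\<le>Suc n. X i \<omega> = s i} =
        measure M {\<omega> \<in> space M. \<forall>i\<le>n. X i \<omega> = s i} * step_prob p (s n) (s (Suc n)))"

text \<open>Times take values in \<open>enat\<close>; the infimum of the empty set is \<open>\<infinity>\<close>.\<close>

definition hitting_time0 :: "(nat \<Rightarrow> 'a \<Rightarrow> nat) \<Rightarrow> 'a \<Rightarrow> enat" where
  "hitting_time0 X \<omega> = Inf (enat ` {n. X n \<omega> = 0})"

definition expected_time :: "'a measure \<Rightarrow> ('a \<Rightarrow> enat) \<Rightarrow> ennreal" where
  "expected_time M S = (\<integral>\<^sup>+ \<omega>. ennreal_of_enat (S \<omega>) \<partial>M)"

definition geometric_restart :: "'b measure \<Rightarrow> real \<Rightarrow> ('b \<Rightarrow> nat) \<Rightarrow> bool" where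
  "geometric_restart N \<rho> R \<longleftrightarrow>
     R \<in> measurable N (count_space UNIV) \<and>
     (\<forall>n\<ge>1. measure N {\<omega> \<in> space N. R \<omega> = n} = \<rho> * (1 - \<rho>) ^ (n - 1))"

text \<open>
  The pairs \<open>(V k, R k)\<close> live on a space \<open>N\<close> of their own. They are i.i.d. copies of
  a pair consisting of \<open>U\<close> and an independent geometric restart time.
\<close>

definition restart_copies ::
  "'a measure \<Rightarrow> ('a \<Rightarrow> enat) \<Rightarrow> real \<Rightarrow> 'b measure \<Rightarrow> (nat \<Rightarrow> 'b \<Rightarrow> enat) \<Rightarrow> (nat \<Rightarrow> 'b \<Rightarrow> nat) \<Rightarrow> bool" where
  "restart_copies M U \<rho> N V R \<longleftrightarrow>
     prob_space N \<and>
     prob_space.indep_vars N (\<lambda>_. count_space UNIV) (\<lambda>k \<omega>. (V k \<omega>, R k \<omega>)) UNIV \<and>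
     (\<forall>k. prob_space.indep_var N (count_space UNIV) (V k) (count_space UNIV) (R k) \<and>
          distr N (count_space UNIV) (V k) = distr M (count_space UNIV) U \<and>
          geometric_restart N \<rho> (R k))"

text \<open>
  The rounds are indexed from \<open>0\<close>. On the null event that every round ends in a restart, the value is
  \<open>\<infinity>\<close>.
\<close>

definition restart_time :: "(nat \<Rightarrow> 'b \<Rightarrow> enat) \<Rightarrow> (nat \<Rightarrow> 'b \<Rightarrow> nat) \<Rightarrow> 'b \<Rightarrow> enat" where
  "restart_time V R \<omega> =
     (if \<exists>k. enat (R k \<omega>) > V k \<omega>
      then (let \<kappa> = (LEAST k. enat (R k \<omega>) > V k \<omega>) in (\<Sum>j<\<kappa>. enat (R j \<omega>)) + V \<kappa> \<omega>)
      else \<infinity>)"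

definition restart_beneficial :: "'a measure \<Rightarrow> ('a \<Rightarrow> enat) \<Rightarrow> 'b measure \<Rightarrow> ('b \<Rightarrow> enat) \<Rightarrow> bool" where
  "restart_beneficial M U N T \<longleftrightarrow> expected_time N T < expected_time M U"

definition m_star :: "real \<Rightarrow> real" where
  "m_star p = (8 * p * (1 - p) - 1) / (2 * p - 1)"

definition p_star :: "nat \<Rightarrow> real" where
  "p_star m = (4 - real m + sqrt ((real m)\<^sup>2 + 8)) / 8"

end

theory Submission
  imports Defs
begin

text \<open>
  Put \<open>s = 1 - \<rho>\<close> and let \<open>l\<close> be the root in \<open>(0,1)\<close> of \<open>l = s (p + q l\<^sup>2)\<close>, the generating function at
  \<open>s\<close> of the time to move one step down. Optional stopping with \<open>1 - l\<^bsup>y\<^esup>\<close> gives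
  \<open>a = \<Sum>n. s\<^bsup>n\<^esup> P(U > n) = (1 - l\<^bsup>m\<^esup>) / \<rho>\<close>, and with \<open>y\<close> it gives \<open>E U = m / (p - q)\<close>. One round lasts
  \<open>a\<close> on average and fails with probability \<open>\<rho> a\<close>, so \<open>E T = a / (1 - \<rho> a)\<close>.

  With \<open>x = 1 / l\<close> as parameter in place of \<open>\<rho>\<close>, this becomes the rational function
  \<open>(\<Sum>k<m. x\<^bsup>k\<^esup>) (p x\<^sup>2 + q) / (p x - q)\<close>, which equals \<open>E U\<close> at \<open>x = 1\<close>, that is at \<open>\<rho> = 0\<close>. After clearing
  denominators, the difference to \<open>E U\<close> is a polynomial in \<open>x - 1\<close> whose linear coefficient has the sign
  of \<open>m - m\<^sup>*\<close>, while all higher coefficients are nonnegative and the quadratic one is positive.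
\<close>

section \<open>The hitting time of the walk\<close>

text \<open>The indicators of the events \<open>Z = z\<close> sum to 1, and Tonelli exchanges the
  countable sum with the integral. This takes the place of conditioning on the path of the
  walk.\<close>

lemma nn_integral_split_countable:
  fixes Z :: "'a \<Rightarrow> 'c::countable"
  assumes [measurable]: "Z \<in> measurable M (count_space UNIV)" "g \<in> borel_measurable M"
  shows "(\<integral>\<^sup>+\<omega>. g \<omega> \<partial>M) =
    (\<integral>\<^sup>+z. (\<integral>\<^sup>+\<omega>. g \<omega> * indicator {\<omega>. Z \<omega> = z} \<omega> \<partial>M) \<partial>count_space UNIV)"
proof -
  have "g \<omega> = (\<integral>\<^sup>+z. g \<omega> * indicator {\<omega>. Z \<omega> = z} \<omega> \<partial>count_space UNIV)" for \<omega>
  proof -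
    have "(\<integral>\<^sup>+z. g \<omega> * indicator {\<omega>. Z \<omega> = z} \<omega> \<partial>count_space UNIV)
        = (\<integral>\<^sup>+z. g \<omega> * indicator {Z \<omega>} z \<partial>count_space UNIV)"
      by (intro nn_integral_cong) (auto simp: indicator_def)
    then show ?thesis
      by (simp add: nn_integral_cmult)
  qed
  then have "(\<integral>\<^sup>+\<omega>. g \<omega> \<partial>M) =
      (\<integral>\<^sup>+\<omega>. (\<integral>\<^sup>+z. g \<omega> * indicator {\<omega>. Z \<omega> = z} \<omega> \<partial>count_space UNIV) \<partial>M)"
    by simp
  also have "\<dots> = (\<integral>\<^sup>+z. (\<integral>\<^sup>+\<omega>. g \<omega> * indicator {\<omega>. Z \<omega> = z} \<omega> \<partial>M) \<partial>count_space UNIV)"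
    by (rule nn_integral_count_space_nn_integral) auto
  finally show ?thesis .
qed

locale walk = prob_space M for M :: "'a measure" +
  fixes m :: nat and p :: real and X :: "nat \<Rightarrow> 'a \<Rightarrow> nat"
  assumes nn_walk: "nn_walk M m p X"
    and p_bounds: "1/2 < p" "p < 1"
    and start_pos: "m \<ge> 1"
begin

lemma X_measurable [measurable]: "X n \<in> measurable M (count_space UNIV)"
  using nn_walk unfolding nn_walk_def by auto

lemma AE_start: "AE \<omega> in M. X 0 \<omega> = m"
  using nn_walk unfolding nn_walk_def by auto

section \<open>Paths and the one-step Markov property\<close>

lemma path_measurable [measurable]:
  "(\<lambda>\<omega>. map (\<lambda>i. X i \<omega>) [0..<n]) \<in> measurable M (count_space UNIV)"
proof -
  have "(\<lambda>\<omega>. map (\<lambda>i. X i \<omega>) [0..<n]) -` {w} \<inter> space M \<in> sets M" for w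
  proof -
    have "map (\<lambda>i. X i \<omega>) [0..<n] = w \<longleftrightarrow> length w = n \<and> (\<forall>i\<in>{..<n}. X i \<omega> = w ! i)" for \<omega>
      unfolding list_eq_iff_nth_eq by auto
    then have "(\<lambda>\<omega>. map (\<lambda>i. X i \<omega>) [0..<n]) -` {w} \<inter> space M =
        {\<omega> \<in> space M. length w = n \<and> (\<forall>i\<in>{..<n}. X i \<omega> = w ! i)}"
      by blast
    also have "\<dots> \<in> sets M"
      by measurable
    finally show ?thesis .
  qed
  then show ?thesis
    unfolding measurable_count_space_eq2_countable by blast
qed

text \<open>This is the event that the hitting time exceeds \<open>n\<close>.\<close>

definition alive :: "nat \<Rightarrow> 'a set" where
  "alive n = {\<omega> \<in> space M. \<forall>i\<in>{..n}. X i \<omega> \<noteq> 0}"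

lemma alive_sets [measurable]: "alive n \<in> sets M"
  unfolding alive_def by measurable

lemma path_prob:
  assumes "s n \<ge> 1"
  shows "prob {\<omega> \<in> space M. \<forall>i\<le>Suc n. X i \<omega> = s i} =
    prob {\<omega> \<in> space M. \<forall>i\<le>n. X i \<omega> = s i} * step_prob p (s n) (s (Suc n))"
  using nn_walk assms unfolding nn_walk_def by blast

lemma nn_integral_step_prob:
  fixes h :: "nat \<Rightarrow> ennreal"
  assumes "x \<ge> 1"
  shows "(\<integral>\<^sup>+y. h y * ennreal (step_prob p x y) \<partial>count_space UNIV)
    = ennreal p * h (x - 1) + ennreal (1 - p) * h (Suc x)"
proof -
  have "(\<integral>\<^sup>+y. h y * ennreal (step_prob p x y) \<partial>count_space UNIV)
     = (\<Sum>y\<in>{x - 1, Suc x}. h y * ennreal (step_prob p x y))"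
    using assms by (intro nn_integral_count_space'[of "{x - 1, Suc x}"]) (auto simp: step_prob_def)
  also have "\<dots> = ennreal p * h (x - 1) + ennreal (1 - p) * h (Suc x)"
    using assms by (simp add: step_prob_def mult.commute)
  finally show ?thesis .
qed

text \<open>On a path \<open>w\<close> of length \<open>Suc n\<close> that avoids 0, the position
  \<open>X n\<close> is the constant \<open>w ! n\<close>, and the transition rule of
  \<open>nn_walk\<close> gives the law of the next position. For every other \<open>w\<close> both
  integrands vanish.\<close>

lemma walk_step_path:
  fixes h :: "nat \<Rightarrow> ennreal" and n :: nat and w :: "nat list"
  defines "D \<equiv> {\<omega>. map (\<lambda>i. X i \<omega>) [0..<Suc n] = w}"
  shows "(\<integral>\<^sup>+\<omega>. h (X (Suc n) \<omega>) * indicator (alive n) \<omega> * indicator D \<omega> \<partial>M) =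
    (\<integral>\<^sup>+\<omega>. (ennreal p * h (X n \<omega> - 1) + ennreal (1 - p) * h (Suc (X n \<omega>)))
        * indicator (alive n) \<omega> * indicator D \<omega> \<partial>M)"
proof (cases "length w = Suc n \<and> (\<forall>i\<le>n. w ! i \<noteq> 0)")
  case False
  then have "indicator (alive n) \<omega> * indicator D \<omega> = (0::ennreal)" for \<omega>
    by (auto simp: indicator_def alive_def D_def simp del: upt_Suc)
  then show ?thesis
    by (simp only: mult.assoc mult_zero_right)
next
  case True
  define C where "C = {\<omega> \<in> space M. \<forall>i\<in>{..n}. X i \<omega> = w ! i}"
  have [measurable]: "C \<in> sets M"
    unfolding C_def by measurable
  have "\<omega> \<in> D \<longleftrightarrow> (\<forall>i\<le>n. X i \<omega> = w ! i)" for \<omega>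
    using True by (simp add: D_def list_eq_iff_nth_eq less_Suc_eq_le del: upt_Suc)
  then have "\<omega> \<in> alive n \<and> \<omega> \<in> D \<longleftrightarrow> \<omega> \<in> C" for \<omega>
    using True by (auto simp: alive_def C_def)
  then have ind: "indicator (alive n) \<omega> * indicator D \<omega> = (indicator C \<omega> :: ennreal)" for \<omega>
    by (auto simp: indicator_def)
  have x: "w ! n \<ge> 1"
    using True by (simp add: Suc_leI)
  have step: "emeasure M {\<omega> \<in> space M. \<omega> \<in> C \<and> X (Suc n) \<omega> = y} =
      ennreal (step_prob p (w ! n) y) * emeasure M C" for y
  proof -
    \<comment> \<open>The transition rule speaks of deterministic sequences, so the path is
      continued by the candidate next position \<open>y\<close>.\<close>
    define s where "s i = (if i \<le> n then w ! i else y)" for i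
    have "{\<omega> \<in> space M. \<omega> \<in> C \<and> X (Suc n) \<omega> = y} = {\<omega> \<in> space M. \<forall>i\<le>Suc n. X i \<omega> = s i}"
      by (auto simp: C_def s_def le_Suc_eq)
    moreover have "C = {\<omega> \<in> space M. \<forall>i\<le>n. X i \<omega> = s i}"
      by (auto simp: C_def s_def)
    moreover have "step_prob p (w ! n) y \<ge> 0"
      using p_bounds by (simp add: step_prob_def)
    ultimately show ?thesis
      using path_prob[of s n] x
      by (simp add: emeasure_eq_measure s_def ennreal_mult[symmetric] mult.commute)
  qed
  have "(\<integral>\<^sup>+\<omega>. h (X (Suc n) \<omega>) * indicator (alive n) \<omega> * indicator D \<omega> \<partial>M)
      = (\<integral>\<^sup>+\<omega>. h (X (Suc n) \<omega>) * indicator C \<omega> \<partial>M)"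
    by (intro nn_integral_cong) (simp add: ind mult.assoc)
  also have "\<dots> = (\<integral>\<^sup>+y. (\<integral>\<^sup>+\<omega>. h (X (Suc n) \<omega>) * indicator C \<omega>
        * indicator {\<omega>. X (Suc n) \<omega> = y} \<omega> \<partial>M) \<partial>count_space UNIV)"
    by (rule nn_integral_split_countable) measurable
  also have "\<dots> = (\<integral>\<^sup>+y. (\<integral>\<^sup>+\<omega>. h y * indicator {\<omega> \<in> space M. \<omega> \<in> C \<and> X (Suc n) \<omega> = y} \<omega> \<partial>M)
      \<partial>count_space UNIV)"
    by (intro nn_integral_cong) (auto simp: indicator_def)
  also have "\<dots> = (\<integral>\<^sup>+y. (h y * ennreal (step_prob p (w ! n) y)) * emeasure M C \<partial>count_space UNIV)"
    by (intro nn_integral_cong, subst nn_integral_cmult_indicator) (auto simp: step mult.assoc)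
  also have "\<dots> = (ennreal p * h (w ! n - 1) + ennreal (1 - p) * h (Suc (w ! n))) * emeasure M C"
    by (subst nn_integral_multc) (use nn_integral_step_prob[OF x, of h] in auto)
  also have "\<dots> = (\<integral>\<^sup>+\<omega>. (ennreal p * h (w ! n - 1) + ennreal (1 - p) * h (Suc (w ! n)))
      * indicator C \<omega> \<partial>M)"
    by (simp add: nn_integral_cmult_indicator)
  also have "\<dots> = (\<integral>\<^sup>+\<omega>. (ennreal p * h (X n \<omega> - 1) + ennreal (1 - p) * h (Suc (X n \<omega>)))
        * indicator (alive n) \<omega> * indicator D \<omega> \<partial>M)"
    by (intro nn_integral_cong, unfold mult.assoc, subst ind) (auto simp: indicator_def C_def)
  finally show ?thesis .
qed

text \<open>One-step Markov property on survival: the identity for a fixed path is summed over the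
  countably many paths up to time \<open>n\<close>.\<close>

lemma walk_step:
  fixes h :: "nat \<Rightarrow> ennreal"
  shows "(\<integral>\<^sup>+\<omega>. h (X (Suc n) \<omega>) * indicator (alive n) \<omega> \<partial>M) =
    (\<integral>\<^sup>+\<omega>. (ennreal p * h (X n \<omega> - 1) + ennreal (1 - p) * h (Suc (X n \<omega>)))
        * indicator (alive n) \<omega> \<partial>M)"
proof -
  have "(\<integral>\<^sup>+\<omega>. g \<omega> * indicator (alive n) \<omega> \<partial>M) =
      (\<integral>\<^sup>+w. (\<integral>\<^sup>+\<omega>. g \<omega> * indicator (alive n) \<omega>
        * indicator {\<omega>. map (\<lambda>i. X i \<omega>) [0..<Suc n] = w} \<omega> \<partial>M) \<partial>count_space UNIV)"
    if [measurable]: "g \<in> borel_measurable M" for g :: "'a \<Rightarrow> ennreal"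
    by (rule nn_integral_split_countable[OF path_measurable]) measurable
  note split = this
  show ?thesis
    by (subst split, measurable, subst split, measurable, simp only: walk_step_path)
qed

text \<open>
  For \<open>\<theta>\<close> strictly between \<open>1\<close> and \<open>p / (1 - p)\<close>, here the midpoint, \<open>\<theta>\<^bsup>x\<^esup>\<close> is an exponential supermartingale.
  It makes the boundary term vanish when a function of the walk is summed along its drift.
\<close>

definition \<theta> :: real where "\<theta> = 1 / (2 * (1 - p))"

text \<open>Equal to \<open>p / \<theta> + (1 - p) * \<theta>\<close>, the factor by which one step
  from a positive state scales the mean of \<open>\<theta> ^ x\<close>.\<close>

definition decay :: real where "decay = 2 * p * (1 - p) + 1/2"

lemma theta_gt_1: "\<theta> > 1"
  using p_bounds by (simp add: \<theta>_def field_simps)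

lemma decay_bounds: "0 < decay" "decay < 1"
proof -
  \<comment> \<open>\<open>1 - decay\<close> equals \<open>(2 * p - 1)\<^sup>2 / 2\<close>.\<close>
  have "0 < (2 * p - 1)\<^sup>2"
    using p_bounds by simp
  then show "decay < 1"
    by (simp add: decay_def power2_eq_square algebra_simps)
  show "0 < decay"
    using p_bounds by (simp add: decay_def add_pos_pos)
qed

lemma theta_step:
  assumes "x \<ge> 1"
  shows "p * \<theta> ^ (x - 1) + (1 - p) * \<theta> ^ Suc x = decay * \<theta> ^ x"
proof -
  obtain y where x: "x = Suc y"
    using assms by (cases x) auto
  have "(1 - p) * \<theta> = 1/2"
    using p_bounds by (simp add: \<theta>_def)
  then have "p + (1 - p) * \<theta>\<^sup>2 = decay * \<theta>"
    unfolding decay_def by algebra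
  then have "(p + (1 - p) * \<theta>\<^sup>2) * \<theta> ^ y = decay * \<theta> * \<theta> ^ y"
    by simp
  then show ?thesis
    by (simp add: x power2_eq_square algebra_simps)
qed

section \<open>Survival and the exponential moment\<close>

lemma alive_0: "emeasure M (alive 0) = 1"
proof -
  have "AE \<omega> in M. \<omega> \<in> alive 0"
    using AE_start AE_space by eventually_elim (use start_pos in \<open>auto simp: alive_def\<close>)
  then show ?thesis
    by (simp add: emeasure_eq_1_AE)
qed

lemma alive_Suc: "\<omega> \<in> alive (Suc n) \<longleftrightarrow> \<omega> \<in> alive n \<and> X (Suc n) \<omega> \<noteq> 0"
  by (auto simp: alive_def le_Suc_eq)

lemma alive_X_pos: "\<omega> \<in> alive n \<Longrightarrow> X n \<omega> \<ge> 1"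
  by (fastforce simp: alive_def Suc_le_eq)

text \<open>Restricting to paths that also avoid 0 at time \<open>Suc n\<close> can only lower the
  integral, and by \<open>theta_step\<close> the step itself contributes the factor
  \<open>decay\<close>.\<close>

lemma theta_moment_le:
  "(\<integral>\<^sup>+\<omega>. ennreal (\<theta> ^ X n \<omega>) * indicator (alive n) \<omega> \<partial>M) \<le> ennreal (decay ^ n * \<theta> ^ m)"
proof (induction n)
  case 0
  have "(\<integral>\<^sup>+\<omega>. ennreal (\<theta> ^ X 0 \<omega>) * indicator (alive 0) \<omega> \<partial>M) \<le> (\<integral>\<^sup>+\<omega>. ennreal (\<theta> ^ m) \<partial>M)"
    using AE_start by (intro nn_integral_mono_AE) (auto simp: indicator_def)
  then show ?case
    by (simp add: emeasure_space_1)
next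
  case (Suc n)
  have "(\<integral>\<^sup>+\<omega>. ennreal (\<theta> ^ X (Suc n) \<omega>) * indicator (alive (Suc n)) \<omega> \<partial>M)
      \<le> (\<integral>\<^sup>+\<omega>. ennreal (\<theta> ^ X (Suc n) \<omega>) * indicator (alive n) \<omega> \<partial>M)"
    by (intro nn_integral_mono) (auto simp: indicator_def alive_Suc)
  also have "\<dots> = (\<integral>\<^sup>+\<omega>. (ennreal p * ennreal (\<theta> ^ (X n \<omega> - 1))
      + ennreal (1 - p) * ennreal (\<theta> ^ Suc (X n \<omega>))) * indicator (alive n) \<omega> \<partial>M)"
    by (rule walk_step)
  also have "\<dots> = (\<integral>\<^sup>+\<omega>. ennreal decay * (ennreal (\<theta> ^ X n \<omega>) * indicator (alive n) \<omega>) \<partial>M)"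
  proof (intro nn_integral_cong)
    fix \<omega> assume "\<omega> \<in> space M"
    have "ennreal p * ennreal (\<theta> ^ (X n \<omega> - 1)) + ennreal (1 - p) * ennreal (\<theta> ^ Suc (X n \<omega>))
        = ennreal decay * ennreal (\<theta> ^ X n \<omega>)" if "\<omega> \<in> alive n"
    proof -
      have "ennreal p * ennreal (\<theta> ^ (X n \<omega> - 1)) + ennreal (1 - p) * ennreal (\<theta> ^ Suc (X n \<omega>))
          = ennreal (p * \<theta> ^ (X n \<omega> - 1) + (1 - p) * \<theta> ^ Suc (X n \<omega>))"
        using p_bounds theta_gt_1 by (simp add: ennreal_mult ennreal_plus del: power_Suc)
      also have "\<dots> = ennreal decay * ennreal (\<theta> ^ X n \<omega>)"
        using theta_step[OF alive_X_pos[OF that]] decay_bounds theta_gt_1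
        by (simp add: ennreal_mult del: power_Suc)
      finally show ?thesis .
    qed
    then show "(ennreal p * ennreal (\<theta> ^ (X n \<omega> - 1)) + ennreal (1 - p) * ennreal (\<theta> ^ Suc (X n \<omega>)))
        * indicator (alive n) \<omega> = ennreal decay * (ennreal (\<theta> ^ X n \<omega>) * indicator (alive n) \<omega>)"
      by (auto simp: indicator_def)
  qed
  also have "\<dots> = ennreal decay * (\<integral>\<^sup>+\<omega>. ennreal (\<theta> ^ X n \<omega>) * indicator (alive n) \<omega> \<partial>M)"
    by (rule nn_integral_cmult) measurable
  also have "\<dots> \<le> ennreal decay * ennreal (decay ^ n * \<theta> ^ m)"
    by (intro mult_left_mono Suc) auto
  also have "\<dots> = ennreal (decay ^ Suc n * \<theta> ^ m)"
    using decay_bounds theta_gt_1 by (simp add: ennreal_mult[symmetric] mult_ac)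
  finally show ?case .
qed

text \<open>Optional stopping in telescoped form: by \<open>harmonic\<close>, the discounted mean of
  \<open>h\<close> on survival drops at time \<open>n\<close> by exactly the \<open>n\<close>-th
  summand. The bound by \<open>C * \<theta> ^ x\<close> makes the boundary term vanish.\<close>

lemma discounted_survival_sum:
  fixes h :: "nat \<Rightarrow> real"
  assumes h: "h 0 = 0" "\<And>x. 0 \<le> h x" "\<And>x. h x \<le> C * \<theta> ^ x"
    and s: "0 \<le> s" "s \<le> 1" and c: "0 \<le> c"
    and harmonic: "\<And>x. x \<ge> 1 \<Longrightarrow> s * (p * h (x - 1) + (1 - p) * h (Suc x)) + c = h x"
  shows "(\<Sum>k. ennreal (c * s ^ k) * emeasure M (alive k)) = ennreal (h m)"
proof -
  define b where "b n = (\<integral>\<^sup>+\<omega>. ennreal (h (X n \<omega>)) * indicator (alive n) \<omega> \<partial>M)" for n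
  have b0: "b 0 = ennreal (h m)"
  proof -
    have "b 0 = (\<integral>\<^sup>+\<omega>. ennreal (h m) * indicator (alive 0) \<omega> \<partial>M)"
      unfolding b_def using AE_start by (intro nn_integral_cong_AE) auto
    then show ?thesis
      by (simp add: nn_integral_cmult_indicator alive_0)
  qed
  have step: "b n = ennreal s * b (Suc n) + ennreal c * emeasure M (alive n)" for n
  proof -
    define g where "g \<omega> = ennreal p * ennreal (h (X n \<omega> - 1)) + ennreal (1 - p) * ennreal (h (Suc (X n \<omega>)))"
      for \<omega>
    have [measurable]: "g \<in> borel_measurable M"
      unfolding g_def by measurable
    \<comment> \<open>Paths that hit 0 at time \<open>Suc n\<close> contribute nothing because
      \<open>h 0 = 0\<close>, so survival up to time \<open>n\<close> may be used instead.\<close>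
    have "b (Suc n) = (\<integral>\<^sup>+\<omega>. ennreal (h (X (Suc n) \<omega>)) * indicator (alive n) \<omega> \<partial>M)"
      unfolding b_def by (intro nn_integral_cong) (auto simp: indicator_def alive_Suc h)
    also have "\<dots> = (\<integral>\<^sup>+\<omega>. g \<omega> * indicator (alive n) \<omega> \<partial>M)"
      unfolding g_def by (rule walk_step)
    finally have "ennreal s * b (Suc n) + ennreal c * emeasure M (alive n) =
        (\<integral>\<^sup>+\<omega>. ennreal s * (g \<omega> * indicator (alive n) \<omega>) + ennreal c * indicator (alive n) \<omega> \<partial>M)"
      by (simp add: nn_integral_add nn_integral_cmult nn_integral_cmult_indicator)
    also have "\<dots> = b n"
      unfolding b_def
    proof (intro nn_integral_cong)
      fix \<omega> assume "\<omega> \<in> space M"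
      have "ennreal s * g \<omega> + ennreal c = ennreal (h (X n \<omega>))" if "\<omega> \<in> alive n"
        using p_bounds s c h(2)
        by (subst harmonic[OF alive_X_pos[OF that], symmetric])
          (simp add: g_def ennreal_mult ennreal_plus)
      then show "ennreal s * (g \<omega> * indicator (alive n) \<omega>) + ennreal c * indicator (alive n) \<omega>
          = ennreal (h (X n \<omega>)) * indicator (alive n) \<omega>"
        by (auto simp: indicator_def)
    qed
    finally show ?thesis by simp
  qed
  have partial: "(\<Sum>k<n. ennreal (c * s ^ k) * emeasure M (alive k)) + ennreal (s ^ n) * b n = ennreal (h m)" for n
  proof (induction n)
    case 0
    then show ?case by (simp add: b0)
  next
    case (Suc n)
    have "ennreal (s ^ n) * b n = ennreal (s ^ Suc n) * b (Suc n)
        + ennreal (c * s ^ n) * emeasure M (alive n)"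
      using s c by (subst step) (simp add: ennreal_mult distrib_left mult_ac)
    then show ?case
      using Suc by (simp add: add_ac)
  qed
  \<comment> \<open>The bound on \<open>h\<close> and \<open>theta_moment_le\<close> dominate this
    by a geometric sequence with ratio \<open>decay\<close>, so the limit is 0 even for
    \<open>s = 1\<close>.\<close>
  have "(\<lambda>n. ennreal (s ^ n) * b n) \<longlonglongrightarrow> 0"
  proof (rule tendsto_sandwich[OF _ _ tendsto_const])
    show "\<forall>\<^sub>F n in sequentially. ennreal (s ^ n) * b n \<le> ennreal (C * \<theta> ^ m * decay ^ n)"
    proof (intro always_eventually allI)
      fix n
      have C: "0 \<le> C"
        using h(2)[of 0] h(3)[of 0] by simp
      have "b n \<le> (\<integral>\<^sup>+\<omega>. ennreal C * (ennreal (\<theta> ^ X n \<omega>) * indicator (alive n) \<omega>) \<partial>M)"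
        unfolding b_def using h(3) C theta_gt_1
        by (intro nn_integral_mono) (auto simp: indicator_def ennreal_mult[symmetric] intro!: ennreal_leI)
      also have "\<dots> = ennreal C * (\<integral>\<^sup>+\<omega>. ennreal (\<theta> ^ X n \<omega>) * indicator (alive n) \<omega> \<partial>M)"
        by (rule nn_integral_cmult) measurable
      also have "\<dots> \<le> ennreal C * ennreal (decay ^ n * \<theta> ^ m)"
        by (intro mult_left_mono theta_moment_le) auto
      also have "\<dots> = ennreal (C * \<theta> ^ m * decay ^ n)"
        using C decay_bounds theta_gt_1 by (simp add: ennreal_mult[symmetric] mult_ac)
      finally have "b n \<le> ennreal (C * \<theta> ^ m * decay ^ n)" .
      moreover have "ennreal (s ^ n) \<le> 1"
        using s by (simp add: power_le_one)
      ultimately show "ennreal (s ^ n) * b n \<le> ennreal (C * \<theta> ^ m * decay ^ n)"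
        using mult_mono[of "ennreal (s ^ n)" 1 "b n"] by fastforce
    qed
    have "(\<lambda>n. C * \<theta> ^ m * decay ^ n) \<longlonglongrightarrow> C * \<theta> ^ m * 0"
      using decay_bounds by (intro tendsto_intros LIMSEQ_power_zero) auto
    then show "(\<lambda>n. ennreal (C * \<theta> ^ m * decay ^ n)) \<longlonglongrightarrow> 0"
      using tendsto_ennrealI by fastforce
  qed auto
  then have "(\<lambda>n. (\<Sum>k<n. ennreal (c * s ^ k) * emeasure M (alive k)) + ennreal (s ^ n) * b n)
      \<longlonglongrightarrow> (\<Sum>k. ennreal (c * s ^ k) * emeasure M (alive k)) + 0"
    by (intro tendsto_add summable_LIMSEQ) auto
  then show ?thesis
    unfolding partial by (simp add: LIMSEQ_const_iff)
qed

text \<open>Take \<open>h x = x\<close> and \<open>s = 1\<close>: the drift towards 0 is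
  \<open>c = 2 * p - 1\<close> per step. Bernoulli's inequality bounds \<open>h\<close> by a
  multiple of \<open>\<theta> ^ x\<close>.\<close>

lemma survival_sum: "(\<Sum>k. emeasure M (alive k)) = ennreal (real m / (2 * p - 1))"
proof -
  have "real x \<le> 1 / (\<theta> - 1) * \<theta> ^ x" for x
    using Bernoulli_inequality[of "\<theta> - 1" x] theta_gt_1 by (simp add: field_simps)
  then have "(\<Sum>k. ennreal ((2 * p - 1) * 1 ^ k) * emeasure M (alive k)) = ennreal (real m)"
    using p_bounds by (intro discounted_survival_sum[where C = "1 / (\<theta> - 1)"])
      (auto simp: algebra_simps of_nat_diff)
  then have "ennreal (2 * p - 1) * (\<Sum>k. emeasure M (alive k)) = ennreal (real m)"
    by simp
  moreover have "ennreal (1 / (2 * p - 1)) * (ennreal (2 * p - 1) * z) = z" for z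
    using p_bounds by (simp add: mult.assoc[symmetric] ennreal_mult[symmetric])
  ultimately have "(\<Sum>k. emeasure M (alive k)) = ennreal (1 / (2 * p - 1)) * ennreal (real m)"
    by metis
  then show ?thesis
    using p_bounds by (simp add: ennreal_mult[symmetric])
qed

text \<open>Take \<open>h x = 1 - l ^ x\<close> and \<open>c = 1 - s\<close>. The equation for
  \<open>l\<close> says that \<open>l ^ x\<close> is harmonic for the walk discounted by
  \<open>s\<close>.\<close>

lemma geometric_survival_sum:
  assumes l: "0 < l" "l < 1" and s: "0 < s" "s < 1" "l = s * (p + (1 - p) * l\<^sup>2)"
  shows "(\<Sum>k. ennreal (s ^ k) * emeasure M (alive k)) = ennreal ((1 - l ^ m) / (1 - s))"
proof -
  have harmonic: "s * (p * (1 - l ^ (x - 1)) + (1 - p) * (1 - l ^ Suc x)) + (1 - s) = 1 - l ^ x"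
    if "x \<ge> 1" for x
  proof -
    obtain y where x: "x = Suc y"
      using \<open>x \<ge> 1\<close> by (cases x) auto
    have "l * l ^ y = s * (p + (1 - p) * l\<^sup>2) * l ^ y"
      using s by simp
    then show ?thesis
      by (simp add: x power2_eq_square algebra_simps)
  qed
  have "1 - l ^ x \<le> 1 * \<theta> ^ x" for x
    using l theta_gt_1 one_le_power[of \<theta> x] zero_le_power[of l x] by linarith
  then have "(\<Sum>k. ennreal ((1 - s) * s ^ k) * emeasure M (alive k)) = ennreal (1 - l ^ m)"
    using l s harmonic by (intro discounted_survival_sum[where C = 1]) (auto simp: power_le_one simp del: power_Suc)
  then have "ennreal (1 - s) * (\<Sum>k. ennreal (s ^ k) * emeasure M (alive k)) = ennreal (1 - l ^ m)"
    using s by (simp add: ennreal_mult mult.assoc)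
  moreover have "ennreal (1 / (1 - s)) * (ennreal (1 - s) * z) = z" for z
    using s by (simp add: mult.assoc[symmetric] ennreal_mult[symmetric])
  ultimately have "(\<Sum>k. ennreal (s ^ k) * emeasure M (alive k)) = ennreal (1 / (1 - s)) * ennreal (1 - l ^ m)"
    by metis
  then show ?thesis
    using s l by (simp add: ennreal_mult[symmetric] power_le_one)
qed

section \<open>The hitting time expressed by survival events\<close>

lemma less_hitting_time_iff:
  assumes "\<omega> \<in> space M"
  shows "enat n < hitting_time0 X \<omega> \<longleftrightarrow> \<omega> \<in> alive n"
proof (cases "\<exists>k. X k \<omega> = 0")
  case True
  define k where "k = (LEAST k. X k \<omega> = 0)"
  have k: "X k \<omega> = 0"
    unfolding k_def using True by (rule LeastI_ex)
  have le: "k \<le> i" if "X i \<omega> = 0" for i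
    unfolding k_def using that by (rule Least_le)
  have "hitting_time0 X \<omega> = enat k"
    unfolding hitting_time0_def using k le by (intro antisym Inf_lower Inf_greatest) auto
  moreover have "n < k \<longleftrightarrow> (\<forall>i\<le>n. X i \<omega> \<noteq> 0)"
    using k le by (meson leD leI le_less_trans)
  ultimately show ?thesis
    using assms by (auto simp: alive_def)
next
  case False
  then have none: "{k. X k \<omega> = 0} = {}"
    by simp
  have "hitting_time0 X \<omega> = \<infinity>"
    unfolding hitting_time0_def none image_empty Inf_empty top_enat_def ..
  then show ?thesis
    using False assms by (simp add: alive_def)
qed

lemma hitting_time_measurable [measurable]: "hitting_time0 X \<in> measurable M (count_space UNIV)"
proof -
  \<comment> \<open>An extended natural number is determined by the naturals strictly below it, so
    the event that the hitting time equals \<open>a\<close> is a countable intersection of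
    conditions on the events \<open>alive n\<close>.\<close>
  have le: "x \<le> a" if "\<forall>n. enat n < x \<longrightarrow> enat n < a" for x a :: enat
  proof (rule ccontr)
    assume "\<not> x \<le> a"
    then obtain k where "a = enat k" "enat k < x"
      by (cases a) auto
    then show False
      using that by auto
  qed
  have "hitting_time0 X \<omega> = a \<longleftrightarrow> (\<forall>n. \<omega> \<in> alive n \<longleftrightarrow> enat n < a)" if "\<omega> \<in> space M" for \<omega> a
    unfolding less_hitting_time_iff[OF that, symmetric] using le by (blast intro: antisym)
  then have "hitting_time0 X -` {a} \<inter> space M = {\<omega> \<in> space M. \<forall>n. \<omega> \<in> alive n \<longleftrightarrow> enat n < a}" for a
    by blast
  moreover have "{\<omega> \<in> space M. \<forall>n. \<omega> \<in> alive n \<longleftrightarrow> enat n < a} \<in> sets M" for a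
    by measurable
  ultimately show ?thesis
    unfolding measurable_count_space_eq2_countable by simp
qed

lemma emeasure_less_hitting_time:
  "emeasure M {\<omega> \<in> space M. enat n < hitting_time0 X \<omega>} = emeasure M (alive n)"
proof -
  have "{\<omega> \<in> space M. enat n < hitting_time0 X \<omega>} = alive n"
    using alive_def less_hitting_time_iff by auto
  then show ?thesis by simp
qed

lemma expected_hitting_time:
  "expected_time M (hitting_time0 X) = ennreal (real m / (2 * p - 1))"
  unfolding expected_time_def
  by (simp add: nn_integral_enat_function emeasure_less_hitting_time survival_sum)

end

section \<open>The first passage time under restart\<close>

locale restart = prob_space N for N :: "'b measure" +
  fixes M :: "'a measure" and U :: "'a \<Rightarrow> enat" and \<rho> :: real
    and V :: "nat \<Rightarrow> 'b \<Rightarrow> enat" and R :: "nat \<Rightarrow> 'b \<Rightarrow> nat"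
  assumes copies: "restart_copies M U \<rho> N V R"
    and U_measurable [measurable]: "U \<in> measurable M (count_space UNIV)"
    and \<rho>_bounds: "0 < \<rho>" "\<rho> < 1"
begin

lemma indep_rounds: "indep_vars (\<lambda>_. count_space UNIV) (\<lambda>k \<omega>. (V k \<omega>, R k \<omega>)) UNIV"
  using copies unfolding restart_copies_def by auto

text \<open>\<^const>\<open>indep_var\<close> needs a common value type, so the coercion \<open>enat\<close> is applied to \<open>R k\<close>.\<close>

lemma indep_V_R: "indep_var (count_space UNIV) (V k) (count_space UNIV) (\<lambda>\<omega>. enat (R k \<omega>))"
  using copies unfolding restart_copies_def by auto

lemma V_measurable [measurable]: "V k \<in> measurable N (count_space UNIV)"
  using indep_V_R[of k] by (rule indep_var_rv1)

lemma R_measurable [measurable]: "R k \<in> measurable N (count_space UNIV)"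
  using copies unfolding restart_copies_def geometric_restart_def by auto

lemma round_measurable [measurable]:
  "(\<lambda>\<omega>. (V k \<omega>, R k \<omega>)) \<in> measurable N (count_space UNIV)"
  using indep_rounds unfolding indep_vars_def by auto

section \<open>A single round\<close>

definition survival :: "nat \<Rightarrow> ennreal" where
  "survival n = emeasure M {\<omega> \<in> space M. enat n < U \<omega>}"

lemma emeasure_V: "emeasure N {\<omega> \<in> space N. enat n < V k \<omega>} = survival n"
proof -
  have "emeasure (distr N (count_space UNIV) (V k)) {x. enat n < x} =
      emeasure (distr M (count_space UNIV) U) {x. enat n < x}"
    using copies unfolding restart_copies_def by auto
  then show ?thesis
    by (simp add: emeasure_distr survival_def vimage_def Int_def conj_commute)
qed

lemma emeasure_R_eq:
  "emeasure N {\<omega> \<in> space N. R k \<omega> = Suc n} = ennreal (\<rho> * (1 - \<rho>) ^ n)"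
proof -
  have "geometric_restart N \<rho> (R k)"
    using copies unfolding restart_copies_def by auto
  then have "measure N {\<omega> \<in> space N. R k \<omega> = Suc n} = \<rho> * (1 - \<rho>) ^ (Suc n - 1)"
    unfolding geometric_restart_def by (metis le_add1 plus_1_eq_Suc)
  then show ?thesis
    by (simp add: emeasure_eq_measure)
qed

lemma emeasure_R_greater: "emeasure N {\<omega> \<in> space N. n < R k \<omega>} = ennreal ((1 - \<rho>) ^ n)"
proof -
  have "{\<omega> \<in> space N. n < R k \<omega>} = (\<Union>j. {\<omega> \<in> space N. R k \<omega> = Suc (n + j)})"
    by (auto dest: less_imp_Suc_add)
  also have "emeasure N \<dots> = (\<Sum>j. emeasure N {\<omega> \<in> space N. R k \<omega> = Suc (n + j)})"
    by (rule suminf_emeasure[symmetric]) (auto simp: disjoint_family_on_def)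
  also have "\<dots> = (\<Sum>j. ennreal ((\<rho> * (1 - \<rho>) ^ n) * (1 - \<rho>) ^ j))"
    by (simp add: emeasure_R_eq power_add mult_ac)
  also have "\<dots> = ennreal ((1 - \<rho>) ^ n)"
  proof (rule suminf_ennreal_eq)
    have "(\<lambda>j. (\<rho> * (1 - \<rho>) ^ n) * (1 - \<rho>) ^ j) sums ((\<rho> * (1 - \<rho>) ^ n) * (1 / (1 - (1 - \<rho>))))"
      using \<rho>_bounds by (intro sums_mult geometric_sums) auto
    then show "(\<lambda>j. (\<rho> * (1 - \<rho>) ^ n) * (1 - \<rho>) ^ j) sums (1 - \<rho>) ^ n"
      using \<rho>_bounds by simp
  qed (use \<rho>_bounds in auto)
  finally show ?thesis .
qed

text \<open>Independence of \<open>V k\<close> and \<open>R k\<close> for events. Since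
  \<open>enat\<close> is injective, any condition on \<open>R k\<close> can be moved through the
  coercion.\<close>

lemma emeasure_V_R:
  "emeasure N {\<omega> \<in> space N. P (V k \<omega>) \<and> Q (R k \<omega>)} =
    emeasure N {\<omega> \<in> space N. P (V k \<omega>)} * emeasure N {\<omega> \<in> space N. Q (R k \<omega>)}"
proof -
  have "prob ((\<lambda>\<omega>. (V k \<omega>, enat (R k \<omega>))) -` (Collect P \<times> enat ` Collect Q) \<inter> space N) =
      prob (V k -` Collect P \<inter> space N) * prob ((\<lambda>\<omega>. enat (R k \<omega>)) -` (enat ` Collect Q) \<inter> space N)"
    by (rule indep_varD[OF indep_V_R]) auto
  moreover have "(\<lambda>\<omega>. (V k \<omega>, enat (R k \<omega>))) -` (Collect P \<times> enat ` Collect Q) \<inter> space N =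
      {\<omega> \<in> space N. P (V k \<omega>) \<and> Q (R k \<omega>)}"
    "V k -` Collect P \<inter> space N = {\<omega> \<in> space N. P (V k \<omega>)}"
    "(\<lambda>\<omega>. enat (R k \<omega>)) -` (enat ` Collect Q) \<inter> space N = {\<omega> \<in> space N. Q (R k \<omega>)}"
    by auto
  ultimately show ?thesis
    by (simp add: emeasure_eq_measure ennreal_mult[symmetric])
qed

text \<open>The mean length of one round, as \<open>expected_run\<close> shows, written as a tail
  sum that matches the discounted survival sum with \<open>s = 1 - \<rho>\<close>.\<close>

definition duration :: ennreal where
  "duration = (\<Sum>n. ennreal ((1 - \<rho>) ^ n) * survival n)"

text \<open>The inequality is weak because a tie counts as a restart.\<close>

definition fails :: "(enat \<times> nat) \<Rightarrow> bool" where
  "fails = (\<lambda>(v, r). enat r \<le> v)"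

text \<open>A failed round lasts \<open>r\<close> and a successful one lasts \<open>v\<close>; in
  both cases this is the minimum.\<close>

definition run :: "(enat \<times> nat) \<Rightarrow> ennreal" where
  "run = (\<lambda>(v, r). ennreal_of_enat (min (enat r) v))"

lemma expected_run: "(\<integral>\<^sup>+\<omega>. run (V k \<omega>, R k \<omega>) \<partial>N) = duration"
proof -
  have "(\<integral>\<^sup>+\<omega>. run (V k \<omega>, R k \<omega>) \<partial>N) =
      (\<Sum>n. emeasure N {\<omega> \<in> space N. enat n < min (enat (R k \<omega>)) (V k \<omega>)})"
    unfolding run_def prod.case by (rule nn_integral_enat_function) measurable
  also have "\<dots> = (\<Sum>n. emeasure N {\<omega> \<in> space N. enat n < V k \<omega> \<and> n < R k \<omega>})"
    by (simp add: conj_commute)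
  also have "\<dots> = duration"
    by (simp add: emeasure_V_R emeasure_V emeasure_R_greater duration_def mult.commute)
  finally show ?thesis .
qed

text \<open>For \<open>R k = Suc n\<close> the round fails exactly if \<open>V k\<close> exceeds
  \<open>n\<close>, and by independence this has probability
  \<open>\<rho> * (1 - \<rho>) ^ n\<close> times \<open>survival n\<close>.\<close>

lemma fail_prob: "(\<integral>\<^sup>+\<omega>. of_bool (fails (V k \<omega>, R k \<omega>)) \<partial>N) = ennreal \<rho> * duration"
proof -
  \<comment> \<open>\<open>geometric_restart\<close> prescribes the masses at
    \<open>n \<ge> 1\<close>; as they sum to 1, the value 0 has probability 0.\<close>
  have "emeasure N {\<omega> \<in> space N. 0 < R k \<omega>} = 1"
    using emeasure_R_greater[of 0 k] by simp
  then have R_pos: "AE \<omega> in N. 0 < R k \<omega>"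
    by (intro AE_I_eq_1) auto
  have "(\<integral>\<^sup>+\<omega>. of_bool (fails (V k \<omega>, R k \<omega>)) \<partial>N) =
      (\<integral>\<^sup>+\<omega>. indicator (\<Union>n. {\<omega> \<in> space N. enat n < V k \<omega> \<and> R k \<omega> = Suc n}) \<omega> \<partial>N)"
  proof (rule nn_integral_cong_AE)
    show "AE \<omega> in N. of_bool (fails (V k \<omega>, R k \<omega>)) =
        (indicator (\<Union>n. {\<omega> \<in> space N. enat n < V k \<omega> \<and> R k \<omega> = Suc n}) \<omega> :: ennreal)"
      using R_pos AE_space
    proof eventually_elim
      case (elim \<omega>)
      then obtain n where "R k \<omega> = Suc n"
        using gr0_implies_Suc by blast
      then show ?case
        using elim by (auto simp: fails_def indicator_def Suc_ile_eq)
    qed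
  qed
  also have "\<dots> = emeasure N (\<Union>n. {\<omega> \<in> space N. enat n < V k \<omega> \<and> R k \<omega> = Suc n})"
    by (rule nn_integral_indicator) measurable
  also have "\<dots> = (\<Sum>n. emeasure N {\<omega> \<in> space N. enat n < V k \<omega> \<and> R k \<omega> = Suc n})"
    by (rule suminf_emeasure[symmetric]) (auto simp: disjoint_family_on_def)
  also have "\<dots> = (\<Sum>n. ennreal \<rho> * (ennreal ((1 - \<rho>) ^ n) * survival n))"
    using \<rho>_bounds
    by (simp add: emeasure_V_R[where Q = "\<lambda>r. r = Suc _"] emeasure_V emeasure_R_eq ennreal_mult mult_ac)
  also have "\<dots> = ennreal \<rho> * duration"
    by (simp add: duration_def)
  finally show ?thesis .
qed

section \<open>The sequence of independent rounds\<close>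

lemma nn_integral_prod_rounds:
  fixes f :: "nat \<Rightarrow> enat \<times> nat \<Rightarrow> ennreal"
  shows "(\<integral>\<^sup>+\<omega>. (\<Prod>i<n. f i (V i \<omega>, R i \<omega>)) \<partial>N) = (\<Prod>i<n. \<integral>\<^sup>+\<omega>. f i (V i \<omega>, R i \<omega>) \<partial>N)"
proof (rule indep_vars_nn_integral)
  show "indep_vars (\<lambda>_. borel) (\<lambda>i \<omega>. f i (V i \<omega>, R i \<omega>)) {..<n}"
    by (rule indep_vars_compose2[OF indep_vars_subset[OF indep_rounds]]) auto
qed auto

text \<open>Round \<open>n\<close> takes place only if all earlier rounds fail. The integrand is a
  product over \<open>Suc n\<close> independent rounds, with failure indicators for
  \<open>i < n\<close> and \<open>run\<close> as the last factor.\<close>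

lemma expected_run_of_round:
  "(\<integral>\<^sup>+\<omega>. (\<Prod>i<n. of_bool (fails (V i \<omega>, R i \<omega>))) * run (V n \<omega>, R n \<omega>) \<partial>N) =
    (ennreal \<rho> * duration) ^ n * duration"
  using nn_integral_prod_rounds[of "\<lambda>i. if i < n then (\<lambda>z. of_bool (fails z)) else run" "Suc n"]
  by (simp add: fail_prob expected_run)

text \<open>The first \<open>n\<close> rounds all fail with probability
  \<open>(ennreal \<rho> * duration) ^ n\<close>, which tends to 0.\<close>

lemma AE_success:
  assumes "ennreal \<rho> * duration < 1"
  shows "AE \<omega> in N. \<exists>k. \<not> fails (V k \<omega>, R k \<omega>)"
proof -
  define F where "F = {\<omega> \<in> space N. \<forall>k. fails (V k \<omega>, R k \<omega>)}"
  have F [measurable]: "F \<in> sets N"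
    unfolding F_def by measurable
  have "emeasure N F \<le> (ennreal \<rho> * duration) ^ n" for n
  proof -
    have "emeasure N F = (\<integral>\<^sup>+\<omega>. indicator F \<omega> \<partial>N)"
      by simp
    also have "\<dots> \<le> (\<integral>\<^sup>+\<omega>. (\<Prod>i<n. of_bool (fails (V i \<omega>, R i \<omega>))) \<partial>N)"
      by (intro nn_integral_mono) (auto simp: indicator_def F_def)
    also have "\<dots> = (ennreal \<rho> * duration) ^ n"
      by (simp add: nn_integral_prod_rounds[where f = "\<lambda>_ z. of_bool (fails z)"] fail_prob)
    finally show ?thesis .
  qed
  moreover obtain r where r: "ennreal \<rho> * duration = ennreal r" "0 \<le> r" "r < 1"
    using assms by (cases "ennreal \<rho> * duration") (auto simp: ennreal_less_one_iff)
  moreover have "(\<lambda>n. ennreal (r ^ n)) \<longlonglongrightarrow> ennreal 0"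
    using r by (intro tendsto_ennrealI LIMSEQ_power_zero) auto
  ultimately have "emeasure N F \<le> 0"
    by (intro LIMSEQ_le_const[of "\<lambda>n. ennreal (r ^ n)"]) (auto simp: ennreal_power)
  then show ?thesis
    using F by (intro AE_I[of _ _ F]) (auto simp: F_def)
qed

text \<open>The product is 1 for \<open>n\<close> up to the first successful round
  \<open>\<kappa>\<close> and 0 afterwards, so the series adds the lengths of the rounds that take
  place. In this form the mean can be taken term by term.\<close>

lemma restart_time_eq_suminf:
  assumes "\<exists>k. \<not> fails (V k \<omega>, R k \<omega>)"
  shows "ennreal_of_enat (restart_time V R \<omega>) =
    (\<Sum>n. (\<Prod>i<n. of_bool (fails (V i \<omega>, R i \<omega>))) * run (V n \<omega>, R n \<omega>))"
proof -
  define \<kappa> where "\<kappa> = (LEAST k. enat (R k \<omega>) > V k \<omega>)"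
  have ex: "\<exists>k. enat (R k \<omega>) > V k \<omega>"
    using assms by (auto simp: fails_def not_le)
  have \<kappa>: "enat (R \<kappa> \<omega>) > V \<kappa> \<omega>"
    unfolding \<kappa>_def using ex by (rule LeastI_ex)
  have before: "enat (R i \<omega>) \<le> V i \<omega>" if "i < \<kappa>" for i
    using that not_less_Least unfolding \<kappa>_def by (metis not_le)
  have "(\<Sum>n. (\<Prod>i<n. of_bool (fails (V i \<omega>, R i \<omega>))) * run (V n \<omega>, R n \<omega>)) =
      (\<Sum>n<Suc \<kappa>. (\<Prod>i<n. of_bool (fails (V i \<omega>, R i \<omega>))) * run (V n \<omega>, R n \<omega>))"
  proof (rule suminf_finite)
    fix n assume "n \<notin> {..<Suc \<kappa>}"
    then have "\<kappa> < n" by auto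
    then have "(\<Prod>i<n. of_bool (fails (V i \<omega>, R i \<omega>))) = (0::ennreal)"
      using \<kappa> by (intro prod_zero) (auto simp: fails_def not_le intro!: bexI[of _ \<kappa>])
    then show "(\<Prod>i<n. of_bool (fails (V i \<omega>, R i \<omega>))) * run (V n \<omega>, R n \<omega>) = 0"
      by simp
  qed auto
  also have "\<dots> = (\<Sum>n<Suc \<kappa>. run (V n \<omega>, R n \<omega>))"
    using before by (intro sum.cong) (auto simp: fails_def)
  also have "\<dots> = ennreal_of_enat (\<Sum>n<\<kappa>. enat (R n \<omega>)) + ennreal_of_enat (V \<kappa> \<omega>)"
    using before \<kappa> by (simp add: run_def min.absorb1 min.absorb2 less_imp_le sum_ennreal_of_enat[symmetric] del: sum_ennreal_of_enat)
  finally show ?thesis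
    using ex by (simp add: restart_time_def \<kappa>_def[symmetric] Let_def)
qed

text \<open>Integrating term by term gives a geometric series with first term \<open>a\<close> and
  ratio \<open>\<rho> * a\<close>, the probability that a round fails.\<close>

lemma expected_restart_time:
  assumes duration: "duration = ennreal a" and a: "0 \<le> a" "\<rho> * a < 1"
  shows "expected_time N (restart_time V R) = ennreal (a / (1 - \<rho> * a))"
proof -
  have \<rho>a: "ennreal \<rho> * duration = ennreal (\<rho> * a)"
    using \<rho>_bounds a by (simp add: duration ennreal_mult)
  have "expected_time N (restart_time V R) =
      (\<integral>\<^sup>+\<omega>. (\<Sum>n. (\<Prod>i<n. of_bool (fails (V i \<omega>, R i \<omega>))) * run (V n \<omega>, R n \<omega>)) \<partial>N)"
    unfolding expected_time_def using AE_success \<rho>a a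
    by (intro nn_integral_cong_AE) (auto simp: restart_time_eq_suminf)
  also have "\<dots> = (\<Sum>n. (ennreal \<rho> * duration) ^ n * duration)"
    by (subst nn_integral_suminf) (auto simp: expected_run_of_round)
  also have "\<dots> = (\<Sum>n. ennreal (a * (\<rho> * a) ^ n))"
    unfolding \<rho>a unfolding duration using \<rho>_bounds a
    by (intro suminf_cong) (simp add: ennreal_power ennreal_mult[symmetric] mult.commute)
  also have "\<dots> = ennreal (a / (1 - \<rho> * a))"
  proof (rule suminf_ennreal_eq)
    have "(\<lambda>n. a * (\<rho> * a) ^ n) sums (a * (1 / (1 - \<rho> * a)))"
      using \<rho>_bounds a by (intro sums_mult geometric_sums) auto
    then show "(\<lambda>n. a * (\<rho> * a) ^ n) sums (a / (1 - \<rho> * a))"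
      by simp
  qed (use \<rho>_bounds a in auto)
  finally show ?thesis .
qed

end

section \<open>Comparison of the two means\<close>

text \<open>After multiplication by \<open>2 * p - 1\<close> the condition is a quadratic inequality
  in \<open>p\<close> whose larger root is \<open>p_star m\<close>; the factor of the smaller root
  is positive for \<open>p > 1/2\<close>.\<close>

lemma m_star_less_iff:
  assumes "1/2 < p"
  shows "real m < m_star p \<longleftrightarrow> p < p_star m"
proof -
  define r where "r = sqrt ((real m)\<^sup>2 + 8)"
  have r_sq: "r\<^sup>2 = (real m)\<^sup>2 + 8"
    by (simp add: r_def)
  have "real m < r"
    unfolding r_def by (rule real_less_rsqrt) simp
  then have pos: "0 < 8 * p - 4 + real m + r"
    using assms by linarith
  have "real m < m_star p \<longleftrightarrow> real m * (2 * p - 1) < 8 * p * (1 - p) - 1"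
    using assms by (simp add: m_star_def less_divide_eq)
  also have "\<dots> \<longleftrightarrow> (8 * p - 4 + real m + r) * (8 * p - 4 + real m - r) < 0"
  proof -
    have "(8 * p - 4 + real m + r) * (8 * p - 4 + real m - r) = (8 * p - 4 + real m)\<^sup>2 - r\<^sup>2"
      by (simp add: power2_eq_square algebra_simps)
    also have "\<dots> = 8 * (real m * (2 * p - 1) - (8 * p * (1 - p) - 1))"
      unfolding r_sq by (simp add: power2_eq_square algebra_simps)
    finally have factored: "(8 * p - 4 + real m + r) * (8 * p - 4 + real m - r) =
      8 * (real m * (2 * p - 1) - (8 * p * (1 - p) - 1))" .
    show ?thesis
      unfolding factored
      by (simp only: less_iff_diff_less_0[of "real m * (2 * p - 1)"] mult_less_0_iff) simp
  qed
  also have "\<dots> \<longleftrightarrow> 8 * p - 4 + real m - r < 0"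
    using pos by (simp add: mult_less_0_iff)
  also have "\<dots> \<longleftrightarrow> p < p_star m"
    by (auto simp: p_star_def r_def)
  finally show ?thesis .
qed

section \<open>The mean under restart and its excess as functions of x\<close>

lemma sum_real_lessThan: "(\<Sum>k<m. real k) = real m * (real m - 1) / 2"
  by (induction m) (auto simp: field_simps)

text \<open>This is \<open>(x ^ m - 1) / \<rho>\<close> with \<open>\<rho>\<close> expressed through
  \<open>x\<close>, after cancelling the factor \<open>x - 1\<close>. The formula therefore makes
  sense at \<open>x = 1\<close>, the limit of no restart.\<close>

definition mean_restart :: "real \<Rightarrow> nat \<Rightarrow> real \<Rightarrow> real" where
  "mean_restart p m x = (\<Sum>k<m. x ^ k) * (p * x\<^sup>2 + (1 - p)) / (p * x - (1 - p))"

text \<open>The difference between \<open>mean_restart p m x\<close> and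
  \<open>real m / (2 * p - 1)\<close>, multiplied by \<open>(2 * p - 1) * (p * x - (1 - p))\<close>,
  which is positive for \<open>p > 1/2\<close> and \<open>x > 1\<close>.\<close>

definition excess :: "real \<Rightarrow> nat \<Rightarrow> real \<Rightarrow> real" where
  "excess p m x = (2 * p - 1) * (\<Sum>k<m. x ^ k) * (p * x\<^sup>2 + (1 - p)) - real m * (p * x - (1 - p))"

text \<open>The derivative of \<open>excess p m\<close> at 1.\<close>

definition excess_slope :: "real \<Rightarrow> nat \<Rightarrow> real" where
  "excess_slope p m = (2 * p - 1) * (real m * (real m - 1) / 2 + 2 * p * real m) - p * real m"

lemma denominator_pos:
  fixes p x :: real
  assumes "1/2 < p" "1 < x"
  shows "0 < p * x - (1 - p)"
proof -
  have "p * 1 \<le> p * x"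
    using assms by (intro mult_left_mono) auto
  then show ?thesis
    using assms by linarith
qed

lemma mean_restart_compare:
  assumes "1/2 < p" "1 < x"
  shows "mean_restart p m x < real m / (2 * p - 1) \<longleftrightarrow> excess p m x < 0"
    "real m / (2 * p - 1) < mean_restart p m x \<longleftrightarrow> 0 < excess p m x"
  using assms denominator_pos[OF assms]
  by (auto simp: mean_restart_def excess_def divide_less_eq less_divide_eq mult_ac)

text \<open>This explains the threshold: for \<open>m \<ge> 1\<close> the slope has the sign of
  \<open>real m - m_star p\<close>.\<close>

lemma excess_slope_eq:
  assumes "1/2 < p"
  shows "2 * excess_slope p m = real m * (2 * p - 1) * (real m - m_star p)"
proof -
  have "(2 * p - 1) * m_star p = 8 * p * (1 - p) - 1"
    using assms by (simp add: m_star_def)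
  then show ?thesis
    unfolding excess_slope_def by (simp add: field_simps) algebra
qed

text \<open>With \<open>x = 1 + t\<close>, Bernoulli's inequality bounds the geometric sum below by
  a linear function of \<open>t\<close>. In the resulting cubic the constant terms cancel and all
  other coefficients are nonnegative.\<close>

lemma excess_pos:
  assumes p: "1/2 < p" "p < 1" and m: "m \<ge> 1" "m_star p \<le> real m" and x: "1 < x"
  shows "0 < excess p m x"
proof -
  define t where "t = x - 1"
  define b where "b = real m * (real m - 1) / 2"
  have t: "0 < t" "x = 1 + t"
    using x by (auto simp: t_def)
  have b: "0 \<le> b"
    using m by (simp add: b_def)
  have "(\<Sum>k<m. 1 + real k * t) \<le> (\<Sum>k<m. x ^ k)"
    using Bernoulli_inequality[of t] t by (intro sum_mono) auto
  then have S: "real m + b * t \<le> (\<Sum>k<m. x ^ k)"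
    by (simp add: sum.distrib sum_distrib_right[symmetric] sum_real_lessThan b_def)
  have quad: "p * x\<^sup>2 + (1 - p) = 1 + 2 * p * t + p * t\<^sup>2"
    by (simp add: t power2_eq_square algebra_simps)
  have "0 \<le> 2 * excess_slope p m"
    unfolding excess_slope_eq[OF p(1)] using p m by (intro mult_nonneg_nonneg) auto
  then have slope: "0 \<le> excess_slope p m"
    by simp
  \<comment> \<open>This part of the quadratic term keeps the inequality strict when the slope is 0,
    that is for \<open>real m = m_star p\<close>.\<close>
  have "0 < (2 * p - 1) * (p * real m * t\<^sup>2)"
    using p m t by simp
  also have "\<dots> \<le> excess_slope p m * t + (2 * p - 1) * (p * real m + 2 * p * b + p * b * t) * t\<^sup>2"
  proof -
    have "(2 * p - 1) * (p * real m) * t\<^sup>2 \<le> (2 * p - 1) * (p * real m + 2 * p * b + p * b * t) * t\<^sup>2"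
      using p b t by (intro mult_right_mono mult_left_mono) auto
    then show ?thesis
      using slope t by (simp add: mult.assoc add_increasing)
  qed
  also have "\<dots> = (2 * p - 1) * (real m + b * t) * (1 + 2 * p * t + p * t\<^sup>2) - real m * (p * x - (1 - p))"
    unfolding t(2) excess_slope_def b_def[symmetric] by (simp add: power2_eq_square algebra_simps)
  also have "\<dots> \<le> excess p m x"
    unfolding excess_def quad using S p t by (intro diff_mono mult_right_mono mult_left_mono) auto
  finally show ?thesis .
qed

text \<open>\<open>excess p m\<close> vanishes at 1 and has a negative derivative there.\<close>

lemma excess_neg_near_1:
  assumes p: "1/2 < p" and m: "m \<ge> 1" "real m < m_star p"
  obtains d where "0 < d" "\<And>x. \<lbrakk>1 < x; x < 1 + d\<rbrakk> \<Longrightarrow> excess p m x < 0"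
proof -
  have "(excess p m has_real_derivative excess_slope p m) (at 1)"
    unfolding excess_def[abs_def] excess_slope_def
    by (auto intro!: derivative_eq_intros simp: sum_real_lessThan field_simps)
  moreover have "excess_slope p m < 0"
  proof -
    have "real m * (2 * p - 1) * (real m - m_star p) < 0"
      using p m by (intro mult_pos_neg) auto
    then show ?thesis
      using excess_slope_eq[OF p, of m] by linarith
  qed
  ultimately obtain d where d: "0 < d" "\<And>h. \<lbrakk>0 < h; h < d\<rbrakk> \<Longrightarrow> excess p m (1 + h) < excess p m 1"
    using DERIV_neg_dec_right by blast
  moreover have "excess p m 1 = 0"
    by (simp add: excess_def algebra_simps)
  ultimately show thesis
    using that[of d] d(2)[of "x - 1" for x] by fastforce
qed

section \<open>From the restart rate to x\<close>

lemma restart_rate_parameter: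
  fixes p \<rho> :: real
  assumes p: "1/2 < p" "p < 1" and \<rho>: "0 < \<rho>" "\<rho> < 1"
  obtains x where "1 < x" "\<rho> * (p * x\<^sup>2 + (1 - p)) = (x - 1) * (p * x - (1 - p))"
proof -
  define f where "f l = l - (1 - \<rho>) * (p + (1 - p) * l\<^sup>2)" for l
  have "\<exists>l. 0 \<le> l \<and> l \<le> 1 \<and> f l = 0"
    \<comment> \<open>\<open>f 0 = - (1 - \<rho>) * p\<close> is negative and
      \<open>f 1 = \<rho>\<close> is positive.\<close>
    using p \<rho> by (intro IVT') (auto simp: f_def intro!: continuous_intros)
  then obtain l where l: "0 \<le> l" "l \<le> 1" "f l = 0"
    by blast
  have "l \<noteq> 0" "l \<noteq> 1"
    using l p \<rho> by (auto simp: f_def)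
  then have "0 < l" "l < 1"
    using l by auto
  \<comment> \<open>A rearrangement of \<open>f l = 0\<close>; division by \<open>l\<^sup>2\<close>
    gives the equation for \<open>x = 1 / l\<close>.\<close>
  moreover have "\<rho> * (p + (1 - p) * l\<^sup>2) = (1 - l) * (p - (1 - p) * l)"
    using l(3) by (simp add: f_def power2_eq_square algebra_simps)
  ultimately show thesis
    by (intro that[of "1 / l"]) (auto simp: field_simps power2_eq_square)
qed

text \<open>With \<open>l = 1 / x\<close> and \<open>a = (1 - l ^ m) / \<rho>\<close>, a round
  succeeds with probability \<open>1 - \<rho> * a = l ^ m\<close>. So the mean is
  \<open>a / l ^ m\<close>, and the equation between \<open>\<rho>\<close> and \<open>x\<close>
  turns this into \<open>mean_restart p m x\<close>.\<close>

lemma expected_restart_time_walk: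
  assumes walk: "nn_walk M m p X" and p: "1/2 < p" "p < 1" and m: "m \<ge> 1"
    and copies: "restart_copies M (hitting_time0 X) \<rho> N V R" and \<rho>: "0 < \<rho>" "\<rho> < 1"
    and x: "1 < x" "\<rho> * (p * x\<^sup>2 + (1 - p)) = (x - 1) * (p * x - (1 - p))"
  shows "expected_time N (restart_time V R) = ennreal (mean_restart p m x)"
proof -
  interpret M: prob_space M
    using walk by (simp add: nn_walk_def)
  interpret W: walk M m p X
    by unfold_locales (use walk p m in auto)
  interpret N: prob_space N
    using copies by (simp add: restart_copies_def)
  interpret R: restart N M "hitting_time0 X" \<rho> V R
    by unfold_locales (use copies \<rho> in auto)
  define l where "l = 1 / x"
  define a where "a = (1 - l ^ m) / \<rho>"
  have l: "0 < l" "l < 1"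
    using x by (auto simp: l_def)
  have root: "l = (1 - \<rho>) * (p + (1 - p) * l\<^sup>2)"
    using x(1) arg_cong[OF x(2), of "\<lambda>z. z / x\<^sup>2"]
    by (simp add: l_def field_simps power2_eq_square)
  have "R.duration = ennreal a"
    using W.geometric_survival_sum[OF l, of "1 - \<rho>"] root \<rho>
    by (simp add: R.duration_def R.survival_def W.emeasure_less_hitting_time a_def)
  moreover have "0 \<le> a"
    using l \<rho> by (simp add: a_def power_le_one)
  moreover have \<rho>a: "\<rho> * a = 1 - l ^ m"
    using \<rho> by (simp add: a_def)
  ultimately have "expected_time N (restart_time V R) = ennreal (a / l ^ m)"
    using R.expected_restart_time[of a] l by simp
  also have "a / l ^ m = mean_restart p m x"
  proof -
    have "\<rho> * (a / l ^ m) = x ^ m - 1"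
    proof -
      have "\<rho> * (a / l ^ m) = (1 - l ^ m) / l ^ m"
        by (simp add: \<rho>a)
      also have "\<dots> = x ^ m - 1"
        using x(1) by (simp add: l_def power_one_over field_simps)
      finally show ?thesis .
    qed
    also have "\<dots> = (x - 1) * (\<Sum>k<m. x ^ k)"
      by (rule power_diff_1_eq)
    also have "\<dots> = \<rho> * mean_restart p m x"
    proof -
      have "\<rho> * mean_restart p m x =
          (\<Sum>k<m. x ^ k) * (\<rho> * (p * x\<^sup>2 + (1 - p))) / (p * x - (1 - p))"
        by (simp add: mean_restart_def)
      then show ?thesis
        unfolding x(2) using denominator_pos[OF p(1) x(1)] by simp
    qed
    finally show ?thesis
      by (rule mult_left_cancel[THEN iffD1, rotated]) (use \<rho> in auto)
  qed
  finally show ?thesis .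
qed


theorem mainTheorem5:
  fixes m :: nat and p :: real
    and M :: "'a measure" and X :: "nat \<Rightarrow> 'a \<Rightarrow> nat" and U :: "'a \<Rightarrow> enat"
    and N :: "real \<Rightarrow> 'b measure" and V :: "real \<Rightarrow> nat \<Rightarrow> 'b \<Rightarrow> enat"
    and R :: "real \<Rightarrow> nat \<Rightarrow> 'b \<Rightarrow> nat" and T :: "real \<Rightarrow> 'b \<Rightarrow> enat"
  assumes "m \<ge> 1" and "1/2 < p" and "p < 1"
    and walk: "nn_walk M m p X"
    and U: "U = hitting_time0 X"
    and copies: "\<And>\<rho>. \<rho> \<in> {0<..<1} \<Longrightarrow> restart_copies M U \<rho> (N \<rho>) (V \<rho>) (R \<rho>)"
    and T: "\<And>\<rho>. T \<rho> = restart_time (V \<rho>) (R \<rho>)"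
  shows "(real m < m_star p \<longleftrightarrow> p < p_star m) \<and>
    (real m < m_star p \<longrightarrow>
       (\<exists>\<rho>'\<in>{0<..<1}. \<forall>\<rho>\<in>{0<..<\<rho>'}. expected_time (N \<rho>) (T \<rho>) < expected_time M U)) \<and>
    (real m \<ge> m_star p \<longrightarrow>
       (\<forall>\<rho>\<in>{0<..<1}. expected_time (N \<rho>) (T \<rho>) > expected_time M U)) \<and>
    (p \<ge> 3/4 \<longrightarrow>
       (\<forall>\<rho>\<in>{0<..<1}. \<not> restart_beneficial M U (N \<rho>) (T \<rho>)))"
proof (intro conjI impI)
  note m = \<open>m \<ge> 1\<close> and p = \<open>1/2 < p\<close> \<open>p < 1\<close>
  interpret M: prob_space M
    using walk by (simp add: nn_walk_def)
  interpret W: walk M m p X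
    by unfold_locales (use walk p m in auto)
  have U_mean: "expected_time M U = ennreal (real m / (2 * p - 1))"
    unfolding U by (rule W.expected_hitting_time)
  have T_mean: "\<exists>x>1. \<rho> * (p * x\<^sup>2 + (1 - p)) = (x - 1) * (p * x - (1 - p)) \<and>
      expected_time (N \<rho>) (T \<rho>) = ennreal (mean_restart p m x)" if \<rho>: "0 < \<rho>" "\<rho> < 1" for \<rho>
  proof -
    obtain x where x: "1 < x" "\<rho> * (p * x\<^sup>2 + (1 - p)) = (x - 1) * (p * x - (1 - p))"
      using restart_rate_parameter[OF p \<rho>] .
    have "restart_copies M (hitting_time0 X) \<rho> (N \<rho>) (V \<rho>) (R \<rho>)"
      using copies \<rho> U by simp
    then show ?thesis
      using expected_restart_time_walk[OF walk p m _ \<rho> x] x by (auto simp: T)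
  qed
  show "real m < m_star p \<longleftrightarrow> p < p_star m"
    using p by (intro m_star_less_iff)
  show "\<exists>\<rho>'\<in>{0<..<1}. \<forall>\<rho>\<in>{0<..<\<rho>'}. expected_time (N \<rho>) (T \<rho>) < expected_time M U"
    if less: "real m < m_star p"
  proof -
    obtain d where d: "0 < d" "\<And>x. \<lbrakk>1 < x; x < 1 + d\<rbrakk> \<Longrightarrow> excess p m x < 0"
      using excess_neg_near_1[OF p(1) m less] by blast
    \<comment> \<open>Chosen so that \<open>\<rho> < \<rho>'\<close> forces
      \<open>x < 1 + d\<close>: the bounds \<open>p * x - (1 - p) \<ge> (2 * p - 1) * x\<close> and
      \<open>p * x\<^sup>2 + (1 - p) \<le> x\<^sup>2\<close> give
      \<open>\<rho> \<ge> (2 * p - 1) * ((x - 1) / x)\<close>, and \<open>(x - 1) / x\<close>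
      increases in \<open>x\<close> with value \<open>d / (1 + d)\<close> at
      \<open>1 + d\<close>.\<close>
    define \<rho>' where "\<rho>' = (2 * p - 1) * (d / (1 + d))"
    have frac: "0 < d / (1 + d)" "d / (1 + d) < 1"
      using d by auto
    have "(2 * p - 1) * (d / (1 + d)) < 1 * 1"
      using p frac by (intro mult_strict_mono) auto
    moreover have "0 < (2 * p - 1) * (d / (1 + d))"
      using p frac by (intro mult_pos_pos) auto
    ultimately have "\<rho>' \<in> {0<..<1}"
      by (simp add: \<rho>'_def)
    moreover have "expected_time (N \<rho>) (T \<rho>) < expected_time M U" if \<rho>: "\<rho> \<in> {0<..<\<rho>'}" for \<rho>
    proof -
      obtain x where x: "1 < x" "\<rho> * (p * x\<^sup>2 + (1 - p)) = (x - 1) * (p * x - (1 - p))"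
        and mean: "expected_time (N \<rho>) (T \<rho>) = ennreal (mean_restart p m x)"
        using T_mean[of \<rho>] \<rho> \<open>\<rho>' \<in> {0<..<1}\<close> by auto
      have "x < 1 + d"
      proof (rule ccontr)
        assume "\<not> x < 1 + d"
        then have large: "1 + d \<le> x" by simp
        have "d / (1 + d) \<le> (x - 1) / x"
          using large d by (simp add: field_simps)
        then have "\<rho>' * x\<^sup>2 \<le> (2 * p - 1) * ((x - 1) / x) * x\<^sup>2"
          unfolding \<rho>'_def using p by (intro mult_right_mono mult_left_mono) auto
        also have "\<dots> = (x - 1) * ((2 * p - 1) * x)"
          using x(1) by (simp add: power2_eq_square)
        also have "\<dots> \<le> (x - 1) * (p * x - (1 - p))"
        proof (intro mult_left_mono)
          have "(1 - p) * 1 \<le> (1 - p) * x"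
            using x p by (intro mult_left_mono) auto
          then show "(2 * p - 1) * x \<le> p * x - (1 - p)"
            by (simp add: algebra_simps)
        qed (use x in auto)
        also have "\<dots> = \<rho> * (p * x\<^sup>2 + (1 - p))"
          using x by simp
        also have "\<dots> \<le> \<rho> * x\<^sup>2"
        proof (intro mult_left_mono)
          have "(1 - p) * 1 \<le> (1 - p) * x\<^sup>2"
            using x p by (intro mult_left_mono one_le_power) auto
          then show "p * x\<^sup>2 + (1 - p) \<le> x\<^sup>2"
            by (simp add: algebra_simps)
        qed (use \<rho> in auto)
        also have "\<dots> < \<rho>' * x\<^sup>2"
          using \<rho> x by (intro mult_strict_right_mono) auto
        finally show False by simp
      qed
      then have "mean_restart p m x < real m / (2 * p - 1)"
        using d x mean_restart_compare(1)[OF p(1) x(1)] by simp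
      then show ?thesis
        using p m by (simp add: mean U_mean ennreal_lessI)
    qed
    ultimately show ?thesis by blast
  qed
  have slower: "\<forall>\<rho>\<in>{0<..<1}. expected_time M U < expected_time (N \<rho>) (T \<rho>)"
    if ge: "m_star p \<le> real m"
  proof
    fix \<rho> :: real assume "\<rho> \<in> {0<..<1}"
    then obtain x where x: "1 < x" and mean: "expected_time (N \<rho>) (T \<rho>) = ennreal (mean_restart p m x)"
      using T_mean[of \<rho>] by auto
    have "real m / (2 * p - 1) < mean_restart p m x"
      using excess_pos[OF p m ge x] mean_restart_compare(2)[OF p(1) x] by simp
    then show "expected_time M U < expected_time (N \<rho>) (T \<rho>)"
      using p by (simp add: mean U_mean ennreal_less_iff)
  qed
  show "\<forall>\<rho>\<in>{0<..<1}. expected_time M U < expected_time (N \<rho>) (T \<rho>)"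
    if "m_star p \<le> real m"
    using slower that .
  show "\<forall>\<rho>\<in>{0<..<1}. \<not> restart_beneficial M U (N \<rho>) (T \<rho>)" if "3/4 \<le> p"
  proof -
    have "m_star p \<le> 1"
    proof -
      \<comment> \<open>Clearing the denominator \<open>2 * p - 1\<close> turns
        \<open>m_star p \<le> 1\<close> into this inequality.\<close>
      have "0 \<le> 2 * p * (4 * p - 3)"
        using that by simp
      then show ?thesis
        using p by (simp add: m_star_def divide_le_eq algebra_simps)
    qed
    then have "m_star p \<le> real m"
      using m by linarith
    then show ?thesis
      using slower by (auto simp: restart_beneficial_def dest: order_less_asym)
  qed
qed

end
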